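(* Let $I\subset\mathbb{R}$ be an interval, let $a,b\in I$ with $a<b$, and let $f:I\to\mathbb{R}$ be twice differentiable on the interior $I^{\circ}$ of $I$, with $f''\in L_1[a,b]$. Let $q>1$ and let $p$ be defined by $\frac1p+\frac1q=1$. If $|f''|^q$ is convex on $[a,b]$, then $$\left|\frac{1}{b-a}\int_a^b f(x)\,dx-f\left(\frac{a+b}{2}\right)\right|\le \frac{(b-a)^2}{8(2p+1)^{1/p}}\left[\frac{|f''(a)|^q+|f''(b)|^q}{2}\right]^{1/q}.$$
   Context: The hypotheses on $f''$ over $[a,b]$ presuppose that $f$ is twice differentiable at every point of $[a,b]$; if $a$ or $b$ is an endpoint of $I$, the derivatives $f'$ and $f''$ there are understood as one-sided derivatives. *)

theory Defs
  imports "HOL-Analysis.Analysis"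
begin

end

theory Submission
  imports Defs
begin

text \<open>Integrating by parts twice on each half of \<open>{a..b}\<close> writes the midpoint error
  \<open>integral {a..b} f - (b - a) * f ((a + b) / 2)\<close> as the integral of \<open>k * f''\<close> with the Peano kernel
  \<open>k x = (min (x - a) (b - x))\<^sup>2 / 2\<close>. Hoelder's inequality then separates \<open>k\<close>, whose \<open>p\<close>-norm is
  explicit, from \<open>f''\<close>, where convexity bounds \<open>\<bar>f''\<bar> powr q\<close> by its secant.\<close>

text \<open>If an argument is 0, the left side is 0 because \<open>0 powr\<close> anything is 0;
  otherwise the positive case applies. Zero has to be allowed since the kernel vanishes at
  \<open>a\<close> and \<open>b\<close>.\<close>

lemma Youngs_inequality_weighted:
  fixes x y :: real
  assumes "0 < \<alpha>" "0 < \<beta>" "\<alpha> + \<beta> = 1" "0 \<le> x" "0 \<le> y"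
  shows "x powr \<alpha> * y powr \<beta> \<le> \<alpha> * x + \<beta> * y"
proof (cases "x = 0 \<or> y = 0")
  case True
  with assms show ?thesis by auto
next
  case False
  with assms show ?thesis by (intro Youngs_inequality_0) auto
qed

text \<open>Young's inequality, applied pointwise to \<open>P\<close> and \<open>Q\<close>
  normalised by their integrals, is integrated. Since \<open>g\<close> is only bounded by the
  product of powers, \<open>Q\<close> may be any majorant of the power of a factor, and the product
  itself is never integrated.\<close>

lemma Hoelder_inequality_has_integral:
  fixes g P Q :: "'a::euclidean_space \<Rightarrow> real"
  assumes g: "(g has_integral J) S"
    and P: "(P has_integral U) S" and Q: "(Q has_integral W) S"
    and P_nonneg: "\<And>x. x \<in> S \<Longrightarrow> 0 \<le> P x" and Q_nonneg: "\<And>x. x \<in> S \<Longrightarrow> 0 \<le> Q x"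
    and bound: "\<And>x. x \<in> S \<Longrightarrow> \<bar>g x\<bar> \<le> P x powr \<alpha> * Q x powr \<beta>"
    and \<alpha>: "0 < \<alpha>" and \<beta>: "0 < \<beta>" and sum1: "\<alpha> + \<beta> = 1"
  shows "\<bar>J\<bar> \<le> U powr \<alpha> * W powr \<beta>"
proof -
  have U: "0 \<le> U" and W: "0 \<le> W"
    using has_integral_nonneg[OF P] has_integral_nonneg[OF Q] P_nonneg Q_nonneg by auto
  \<comment> \<open>The shift by \<open>e\<close> allows the normalisation also when \<open>U\<close> or \<open>W\<close> vanishes.\<close>
  have shifted: "\<bar>J\<bar> \<le> (U + e) powr \<alpha> * (W + e) powr \<beta>" if e: "0 < e" for e
  proof -
    define c where "c = (U + e) powr \<alpha> * (W + e) powr \<beta>"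
    have c: "0 < c"
      unfolding c_def using U W e by simp
    \<comment> \<open>The right side of Young's inequality for \<open>P x / (U + e)\<close> and
      \<open>Q x / (W + e)\<close>, scaled back by \<open>c\<close>. Its integral is at most
      \<open>c * (\<alpha> + \<beta>) = c\<close>.\<close>
    define h where "h x = c * (\<alpha> / (U + e) * P x + \<beta> / (W + e) * Q x)" for x
    have h: "(h has_integral c * (\<alpha> / (U + e) * U + \<beta> / (W + e) * W)) S"
      unfolding h_def by (intro has_integral_mult_right has_integral_add P Q)
    have le: "\<bar>g x\<bar> \<le> h x" if x: "x \<in> S" for x
    proof -
      have "P x powr \<alpha> * Q x powr \<beta>
          = c * ((P x / (U + e)) powr \<alpha> * (Q x / (W + e)) powr \<beta>)"
        unfolding c_def using P_nonneg[OF x] Q_nonneg[OF x] U W e by (simp add: powr_divide)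
      also have "\<dots> \<le> c * (\<alpha> * (P x / (U + e)) + \<beta> * (Q x / (W + e)))"
        using P_nonneg[OF x] Q_nonneg[OF x] U W e c \<alpha> \<beta> sum1
        by (intro mult_left_mono Youngs_inequality_weighted) simp_all
      finally show ?thesis
        using bound[OF x] by (simp add: h_def)
    qed
    have "J \<le> c * (\<alpha> / (U + e) * U + \<beta> / (W + e) * W)"
      using le by (intro has_integral_le[OF g h]) (simp add: abs_le_iff)
    moreover have "- J \<le> c * (\<alpha> / (U + e) * U + \<beta> / (W + e) * W)"
      using le by (intro has_integral_le[OF has_integral_neg[OF g] h]) (simp add: abs_le_iff)
    moreover have "\<alpha> / (U + e) * U + \<beta> / (W + e) * W \<le> \<alpha> + \<beta>"
      using U W e \<alpha> \<beta> by (intro add_mono) (simp_all add: field_simps)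
    then have "c * (\<alpha> / (U + e) * U + \<beta> / (W + e) * W) \<le> c"
      using c sum1 by (metis less_imp_le mult.right_neutral mult_left_mono)
    ultimately show ?thesis
      unfolding c_def by linarith
  qed
  \<comment> \<open>The limit has to be one-sided: at base 0, continuity of \<open>powr\<close>
    rests on a positive exponent and on a base that stays nonnegative.\<close>
  have "((\<lambda>e. (U + e) powr \<alpha> * (W + e) powr \<beta>) \<longlongrightarrow> (U + 0) powr \<alpha> * (W + 0) powr \<beta>)
      (at_right 0)"
    using U W \<alpha> \<beta>
    by (intro tendsto_intros disjI2 conjI) (auto simp: eventually_at_filter)
  then show ?thesis
    using shifted
    by (intro tendsto_lowerbound[where F = "at_right 0" and f = "\<lambda>e. (U + e) powr \<alpha> * (W + e) powr \<beta>"])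
      (auto simp: eventually_at_filter)
qed

text \<open>The derivative rule for \<open>powr\<close> is applied only where the base is positive,
  so at \<open>a\<close> the antiderivative enters through continuity alone.\<close>

lemma has_integral_powr_diff_left:
  fixes a c s :: real
  assumes "a \<le> c" and "0 < s"
  shows "((\<lambda>x. (x - a) powr s) has_integral (c - a) powr (s + 1) / (s + 1)) {a..c}"
proof -
  have "((\<lambda>x. (x - a) powr s) has_integral
      (c - a) powr (s + 1) / (s + 1) - (a - a) powr (s + 1) / (s + 1)) {a..c}"
    using assms
    by (intro fundamental_theorem_of_calculus_interior continuous_intros continuous_on_powr')
      (auto intro!: derivative_eq_intros simp flip: has_real_derivative_iff_has_vector_derivative)
  then show ?thesis
    by simp
qed

lemma has_integral_powr_diff_right:
  fixes b c s :: real
  assumes "c \<le> b" and "0 < s"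
  shows "((\<lambda>x. (b - x) powr s) has_integral (b - c) powr (s + 1) / (s + 1)) {c..b}"
proof -
  have "((\<lambda>x. (b - x) powr s) has_integral
      - ((b - b) powr (s + 1) / (s + 1)) - - ((b - c) powr (s + 1) / (s + 1))) {c..b}"
    using assms
    by (intro fundamental_theorem_of_calculus_interior continuous_intros continuous_on_powr')
      (auto intro!: derivative_eq_intros simp flip: has_real_derivative_iff_has_vector_derivative)
  then show ?thesis
    by simp
qed

text \<open>Both integrations by parts are condensed into one explicit antiderivative per half, in
  which the terms with \<open>f'\<close> cancel upon differentiation. Integrability of the product
  with \<open>f''\<close> then comes with the fundamental theorem for the gauge integral.\<close>

lemma has_integral_midpoint_kernel:
  fixes f f' f'' :: "real \<Rightarrow> real"
  assumes "a < b"
    and f: "\<And>x. x \<in> {a..b} \<Longrightarrow> (f has_real_derivative f' x) (at x within {a..b})"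
    and f': "\<And>x. x \<in> {a..b} \<Longrightarrow> (f' has_real_derivative f'' x) (at x within {a..b})"
  shows "((\<lambda>x. (min (x - a) (b - x))\<^sup>2 / 2 * f'' x) has_integral
    integral {a..b} f - (b - a) * f ((a + b) / 2)) {a..b}"
proof -
  define m where "m = (a + b) / 2"
  have m: "a \<le> m" "m \<le> b" "m - a = (b - a) / 2" "b - m = (b - a) / 2"
    using \<open>a < b\<close> by (auto simp: m_def field_simps)
  have "continuous_on {a..b} f"
    using f by (meson DERIV_continuous_on)
  then have f_int: "(f has_integral integral {a..b} f) {a..b}"
    by (intro integrable_integral integrable_continuous_interval)
  \<comment> \<open>Subtracting \<open>f\<close> turns the integrand into an exact derivative on
    each half; \<open>f\<close> is added back at the end.\<close>
  define d where "d x = (min (x - a) (b - x))\<^sup>2 / 2 * f'' x - f x" for x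
  have left: "(d has_integral ((m - a)\<^sup>2 / 2 * f' m - (m - a) * f m) -
      ((a - a)\<^sup>2 / 2 * f' a - (a - a) * f a)) {a..m}"
  proof (rule fundamental_theorem_of_calculus[OF \<open>a \<le> m\<close>])
    fix x assume x: "x \<in> {a..m}"
    have [derivative_intros]: "(f has_real_derivative f' x) (at x within {a..m})"
        "(f' has_real_derivative f'' x) (at x within {a..m})"
      using x m by (auto intro: DERIV_subset[OF f] DERIV_subset[OF f'])
    have "((\<lambda>x. (x - a)\<^sup>2 / 2 * f' x - (x - a) * f x) has_real_derivative
        (x - a)\<^sup>2 / 2 * f'' x - f x) (at x within {a..m})"
      by (auto intro!: derivative_eq_intros simp: field_simps)
    moreover have "min (x - a) (b - x) = x - a"
      using x by (auto simp: m_def min_def)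
    ultimately show "((\<lambda>x. (x - a)\<^sup>2 / 2 * f' x - (x - a) * f x) has_vector_derivative d x)
        (at x within {a..m})"
      by (simp add: d_def has_real_derivative_iff_has_vector_derivative)
  qed
  have right: "(d has_integral ((b - b)\<^sup>2 / 2 * f' b + (b - b) * f b) -
      ((b - m)\<^sup>2 / 2 * f' m + (b - m) * f m)) {m..b}"
  proof (rule fundamental_theorem_of_calculus[OF \<open>m \<le> b\<close>])
    fix x assume x: "x \<in> {m..b}"
    have [derivative_intros]: "(f has_real_derivative f' x) (at x within {m..b})"
        "(f' has_real_derivative f'' x) (at x within {m..b})"
      using x m by (auto intro: DERIV_subset[OF f] DERIV_subset[OF f'])
    have "((\<lambda>x. (b - x)\<^sup>2 / 2 * f' x + (b - x) * f x) has_real_derivative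
        (b - x)\<^sup>2 / 2 * f'' x - f x) (at x within {m..b})"
      by (auto intro!: derivative_eq_intros simp: field_simps)
    moreover have "min (x - a) (b - x) = b - x"
      using x by (auto simp: m_def min_def)
    ultimately show "((\<lambda>x. (b - x)\<^sup>2 / 2 * f' x + (b - x) * f x) has_vector_derivative d x)
        (at x within {m..b})"
      by (simp add: d_def has_real_derivative_iff_has_vector_derivative)
  qed
  \<comment> \<open>The boundary terms at \<open>a\<close> and \<open>b\<close> vanish. At
    \<open>m\<close> the two terms with \<open>f' m\<close> cancel, as \<open>m\<close> is
    equidistant from both ends, and those with \<open>f m\<close> add up.\<close>
  have "((\<lambda>x. d x + f x) has_integral - (b - a) * f m + integral {a..b} f) {a..b}"
    by (rule has_integral_eq_rhs[OF has_integral_add[OF has_integral_combine[OF m(1,2) left right] f_int]])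
      (simp add: m algebra_simps)
  then show ?thesis
    by (simp add: d_def m_def algebra_simps)
qed

text \<open>The integrand is the \<open>p\<close>-th power of the Peano kernel. The value is
  arranged so that its \<open>p\<close>-th root shows the factor \<open>(b - a)\<^sup>2 / 8\<close>
  of the final bound.\<close>

lemma has_integral_midpoint_kernel_powr:
  fixes a b p :: real
  assumes "a < b" and p: "0 < p"
  shows "((\<lambda>x. min (x - a) (b - x) powr (2 * p) / 2 powr p) has_integral
    (b - a) * ((b - a)\<^sup>2 / 8) powr p / (2 * p + 1)) {a..b}"
proof -
  define m where "m = (a + b) / 2"
  have m: "a \<le> m" "m \<le> b" "m - a = (b - a) / 2" "b - m = (b - a) / 2"
    using \<open>a < b\<close> by (auto simp: m_def field_simps)
  let ?k = "\<lambda>x. min (x - a) (b - x) powr (2 * p)"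
  have "(?k has_integral (m - a) powr (2 * p + 1) / (2 * p + 1)) {a..m}"
    using m p
    by (intro has_integral_eq[OF _ has_integral_powr_diff_left]) (auto simp: m_def min_absorb1)
  moreover have "(?k has_integral (b - m) powr (2 * p + 1) / (2 * p + 1)) {m..b}"
    using m p
    by (intro has_integral_eq[OF _ has_integral_powr_diff_right]) (auto simp: m_def min_absorb2)
  ultimately have "(?k has_integral
      (m - a) powr (2 * p + 1) / (2 * p + 1) + (b - m) powr (2 * p + 1) / (2 * p + 1)) {a..b}"
    by (rule has_integral_combine[OF m(1,2)])
  note k = has_integral_divide[OF this, of "2 powr p"]
  have "((b - a) / 2) powr (2 * p + 1) = (b - a) / 2 * (((b - a) / 2)\<^sup>2) powr p"
    using assms by (simp add: powr_add powr_powr flip: powr_numeral)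
  \<comment> \<open>The 8 arises from
    \<open>(b - a)\<^sup>2 / 4 = 2 * ((b - a)\<^sup>2 / 8)\<close>; the extra
    \<open>2 powr p\<close> cancels the denominator of the kernel's power.\<close>
  also have "(((b - a) / 2)\<^sup>2) powr p = ((b - a)\<^sup>2 / 8) powr p * 2 powr p"
    by (simp add: power_divide flip: powr_mult)
  finally have half:
    "((b - a) / 2) powr (2 * p + 1) = (b - a) / 2 * (((b - a)\<^sup>2 / 8) powr p * 2 powr p)" .
  show ?thesis
    by (rule has_integral_eq_rhs[OF k], unfold m half, simp)
      (use p in \<open>simp add: field_simps\<close>)
qed

theorem theorem4:
  fixes I :: "real set" and f f' f'' :: "real \<Rightarrow> real" and a b p q :: real
  assumes "is_interval I"
    and "a \<in> I" and "b \<in> I" and "a < b"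
    and "\<And>x. x \<in> interior I \<union> {a..b} \<Longrightarrow> (f has_real_derivative f' x) (at x within I)"
    and "\<And>x. x \<in> interior I \<union> {a..b} \<Longrightarrow> (f' has_real_derivative f'' x) (at x within I)"
    and "f'' absolutely_integrable_on {a..b}"
    and "q > 1" and "1 / p + 1 / q = 1"
    and "convex_on {a..b} (\<lambda>x. \<bar>f'' x\<bar> powr q)"
  shows "\<bar>1 / (b - a) * integral {a..b} f - f ((a + b) / 2)\<bar>
      \<le> (b - a)\<^sup>2 / (8 * (2 * p + 1) powr (1 / p))
        * ((\<bar>f'' a\<bar> powr q + \<bar>f'' b\<bar> powr q) / 2) powr (1 / q)"
proof -
  have sub: "{a..b} \<subseteq> I"
    using assms(1-3) unfolding is_interval_1 by (meson atLeastAtMost_iff subsetI)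
  \<comment> \<open>From \<open>q > 1\<close> follows \<open>1 / q < 1\<close>. As
    \<open>1 / 0 = 0\<close>, positivity of \<open>1 / p\<close> also rules out
    \<open>p = 0\<close>.\<close>
  have "0 < 1 / p"
    using \<open>q > 1\<close> \<open>1 / p + 1 / q = 1\<close> by (smt (verit) divide_less_eq_1)
  then have p: "0 < p"
    by simp
  define A B where "A = \<bar>f'' a\<bar> powr q" and "B = \<bar>f'' b\<bar> powr q"
  define s where "s = (B - A) / (b - a)"
  define J where "J = integral {a..b} f - (b - a) * f ((a + b) / 2)"
  let ?P = "\<lambda>x. min (x - a) (b - x) powr (2 * p) / 2 powr p"
  \<comment> \<open>The chord of \<open>\<bar>f'' x\<bar> powr q\<close> over \<open>{a..b}\<close>;
    its mean value is \<open>(A + B) / 2\<close>.\<close>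
  let ?Q = "\<lambda>x. s * (x - a) + A"
  have J: "((\<lambda>x. (min (x - a) (b - x))\<^sup>2 / 2 * f'' x) has_integral J) {a..b}"
    unfolding J_def using sub assms(5,6)
    by (intro has_integral_midpoint_kernel[where f' = f'] \<open>a < b\<close>) (blast intro: DERIV_subset)+
  have P: "(?P has_integral (b - a) * ((b - a)\<^sup>2 / 8) powr p / (2 * p + 1)) {a..b}"
    using \<open>a < b\<close> p by (rule has_integral_midpoint_kernel_powr)
  have lin: "(?Q has_integral
      s * ((b - a)\<^sup>2 / 2) + A * (b - a) - (s * ((a - a)\<^sup>2 / 2) + A * (a - a))) {a..b}"
    using \<open>a < b\<close>
    by (intro fundamental_theorem_of_calculus[where f = "\<lambda>x. s * ((x - a)\<^sup>2 / 2) + A * (x - a)"])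
      (auto intro!: derivative_eq_intros simp flip: has_real_derivative_iff_has_vector_derivative)
  have B: "B = A + s * (b - a)"
    using \<open>a < b\<close> by (simp add: s_def)
  have Q: "(?Q has_integral (b - a) * ((A + B) / 2)) {a..b}"
    unfolding B by (rule has_integral_eq_rhs[OF lin]) (simp add: power2_eq_square field_simps)
  have secant: "\<bar>f'' x\<bar> powr q \<le> ?Q x" if "x \<in> {a..b}" for x
    using convex_onD_Icc'[OF assms(10) that] by (simp add: s_def A_def B_def)
  \<comment> \<open>Convexity enters pointwise: the chord itself, not the function below it, serves
    as the second factor in Hoelder's inequality.\<close>
  have "\<bar>J\<bar> \<le> ((b - a) * ((b - a)\<^sup>2 / 8) powr p / (2 * p + 1)) powr (1 / p)
      * ((b - a) * ((A + B) / 2)) powr (1 / q)"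
  proof (rule Hoelder_inequality_has_integral[OF J P Q])
    fix x assume x: "x \<in> {a..b}"
    show "0 \<le> ?Q x"
      using secant[OF x] by (rule order_trans[rotated]) simp
    have "\<bar>f'' x\<bar> = (\<bar>f'' x\<bar> powr q) powr (1 / q)"
      using \<open>q > 1\<close> by (simp add: powr_powr)
    also have "\<dots> \<le> ?Q x powr (1 / q)"
      using secant[OF x] \<open>q > 1\<close> by (intro powr_mono2) auto
    finally have f''_le: "\<bar>f'' x\<bar> \<le> ?Q x powr (1 / q)" .
    have kernel: "?P x powr (1 / p) = (min (x - a) (b - x))\<^sup>2 / 2"
      using x p by (simp add: powr_divide powr_powr)
    show "\<bar>(min (x - a) (b - x))\<^sup>2 / 2 * f'' x\<bar> \<le> ?P x powr (1 / p) * ?Q x powr (1 / q)"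
      unfolding kernel abs_mult using f''_le by (intro mult_mono) auto
  qed (use \<open>0 < 1 / p\<close> \<open>q > 1\<close> \<open>1 / p + 1 / q = 1\<close> in auto)
  also have "\<dots> = (b - a) powr (1 / p) * (b - a) powr (1 / q) * ((b - a)\<^sup>2 / 8 / (2 * p + 1) powr (1 / p)
      * ((A + B) / 2) powr (1 / q))"
    using \<open>a < b\<close> p by (simp add: A_def B_def powr_mult powr_divide powr_powr)
  \<comment> \<open>The lengths from the two norms combine to one factor \<open>b - a\<close>, which
    the division in the mean value removes.\<close>
  also have "(b - a) powr (1 / p) * (b - a) powr (1 / q) = b - a"
    using \<open>a < b\<close> \<open>1 / p + 1 / q = 1\<close> by (simp flip: powr_add)
  finally have "\<bar>J\<bar> / (b - a) \<le> (b - a)\<^sup>2 / 8 / (2 * p + 1) powr (1 / p) * ((A + B) / 2) powr (1 / q)"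
    using \<open>a < b\<close> by (simp add: pos_divide_le_eq mult.commute)
  moreover have "1 / (b - a) * integral {a..b} f - f ((a + b) / 2) = J / (b - a)"
    using \<open>a < b\<close> by (simp add: J_def diff_divide_distrib)
  ultimately show ?thesis
    using \<open>a < b\<close> by (simp add: A_def B_def)
qed

end
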